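(* Let $(W,S)$ be a Coxeter system and let $(X,\mathrm{ht})$ be an even bounded quasiparabolic $W$-set, with Bruhat order $\le$. Then the Möbius function of the poset $(X,\le)$ is given by $$\mu(x,y)=\begin{cases}(-1)^{\mathrm{ht}(y)-\mathrm{ht}(x)} & x\le y,\\ 0&\text{otherwise.}\end{cases}$$ Equivalently, any interval $[x,y]$ with $x<y$ has equal numbers of elements of odd height and of even height.
   Context: Coxeter systems $(W,S)$ have finite rank; $R(W)$ is the set of reflections, i.e. conjugates in $W$ of elements of $S$; $\ell$ is the length function. A scaled $W$-set is a pair $(X,\mathrm{ht})$ with $X$ a (left) $W$-set and $\mathrm{ht}:X\to\mathbb Z$ a function with $|\mathrm{ht}(sx)-\mathrm{ht}(x)|\le 1$ for all $s\in S$, $x\in X$. A quasiparabolic $W$-set is a scaled $W$-set such that (QP1) for all $r\in R(W)$, $x\in X$, if $\mathrm{ht}(rx)=\mathrm{ht}(x)$ then $rx=x$; and (QP2) for all $r\in R(W)$, $x\in X$, $s\in S$, if $\mathrm{ht}(rx)>\mathrm{ht}(x)$ and $\mathrm{ht}(srx)<\mathrm{ht}(sx)$, then $rx=sx$. It is even if $wx=x$ ($w\in W$, $x\in X$) implies that $\ell(w)$ is even. "Bounded" means that the height function is bounded from below or bounded from above. The Bruhat order on a quasiparabolic $W$-set is the weakest partial order such that for $x\in X$, $r\in R(W)$, $x\le rx$ iff $\mathrm{ht}(x)\le\mathrm{ht}(rx)$ (i.e. the reflexive-transitive closure of the relations $x<rx$ with $r \in R(W)$, $\mathrm{ht}(x)<\mathrm{ht}(rx)$).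 *)

theory Defs
  imports "HOL-Algebra.Group_Action"
begin

section \<open>Coxeter systems\<close>

text \<open>
  A Coxeter matrix on \<^term>\<open>S\<close>. The value \<open>0\<close> encodes \<open>m(s,t) = \<infinity>\<close>, so that \<open>m(s,t) \<noteq> 1\<close>
  says \<open>m(s,t) \<in> {2, 3, \<dots>, \<infinity>}\<close>.
\<close>

definition coxeter_matrix :: "'w set \<Rightarrow> ('w \<Rightarrow> 'w \<Rightarrow> nat) \<Rightarrow> bool" where
  "coxeter_matrix S m \<longleftrightarrow>
     (\<forall>s\<in>S. m s s = 1) \<and>
     (\<forall>s\<in>S. \<forall>t\<in>S. m s t = m t s) \<and>
     (\<forall>s\<in>S. \<forall>t\<in>S. s \<noteq> t \<longrightarrow> m s t \<noteq> 1)"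

text \<open>
  Insertion of a relator \<open>(st)^m(s,t)\<close> into a word. For \<open>m(s,t) = \<infinity>\<close> the inserted word is empty,
  that is, there is no relation. The equivalence closure is the congruence generated by the
  relations; since these include \<open>s\<^sup>2 = 1\<close>, the monoid they present is the group they present, and
  words need no inverse letters.
\<close>

inductive coxeter_step ::
  "'w set \<Rightarrow> ('w \<Rightarrow> 'w \<Rightarrow> nat) \<Rightarrow> 'w list \<Rightarrow> 'w list \<Rightarrow> bool" for S m where
  "\<lbrakk> u \<in> lists S; v \<in> lists S; s \<in> S; t \<in> S \<rbrakk>
   \<Longrightarrow> coxeter_step S m (u @ v) (u @ concat (replicate (m s t) [s, t]) @ v)"

definition word_eval :: "('w, 'c) monoid_scheme \<Rightarrow> 'w list \<Rightarrow> 'w" where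
  "word_eval W ws = foldr (\<otimes>\<^bsub>W\<^esub>) ws \<one>\<^bsub>W\<^esub>"

text \<open>
  The last two conditions say that evaluation of words induces an isomorphism from the group
  presented by \<open>\<langle>S | (st)^m(s,t) = 1\<rangle>\<close> onto \<^term>\<open>W\<close>.
\<close>

definition coxeter_system :: "('w, 'c) monoid_scheme \<Rightarrow> 'w set \<Rightarrow> bool" where
  "coxeter_system W S \<longleftrightarrow>
     group W \<and> finite S \<and> S \<subseteq> carrier W \<and>
     (\<exists>m. coxeter_matrix S m \<and>
          word_eval W ` lists S = carrier W \<and>
          (\<forall>u\<in>lists S. \<forall>v\<in>lists S.
             word_eval W u = word_eval W v \<longleftrightarrow> equivclp (coxeter_step S m) u v))"

definition reflections :: "('w, 'c) monoid_scheme \<Rightarrow> 'w set \<Rightarrow> 'w set" where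
  "reflections W S = {w \<otimes>\<^bsub>W\<^esub> s \<otimes>\<^bsub>W\<^esub> inv\<^bsub>W\<^esub> w | w s. w \<in> carrier W \<and> s \<in> S}"

definition cox_length :: "('w, 'c) monoid_scheme \<Rightarrow> 'w set \<Rightarrow> 'w \<Rightarrow> nat" where
  "cox_length W S w = (LEAST n. \<exists>ws\<in>lists S. length ws = n \<and> word_eval W ws = w)"


section \<open>Quasiparabolic sets\<close>

definition scaled_set ::
  "('w, 'c) monoid_scheme \<Rightarrow> 'w set \<Rightarrow> 'x set \<Rightarrow> ('w \<Rightarrow> 'x \<Rightarrow> 'x) \<Rightarrow> ('x \<Rightarrow> int) \<Rightarrow> bool" where
  "scaled_set W S X act ht \<longleftrightarrow>
     group_action W X act \<and>
     (\<forall>s\<in>S. \<forall>x\<in>X. \<bar>ht (act s x) - ht x\<bar> \<le> 1)"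

definition quasiparabolic_set ::
  "('w, 'c) monoid_scheme \<Rightarrow> 'w set \<Rightarrow> 'x set \<Rightarrow> ('w \<Rightarrow> 'x \<Rightarrow> 'x) \<Rightarrow> ('x \<Rightarrow> int) \<Rightarrow> bool" where
  "quasiparabolic_set W S X act ht \<longleftrightarrow>
     scaled_set W S X act ht \<and>
     (\<forall>r\<in>reflections W S. \<forall>x\<in>X. ht (act r x) = ht x \<longrightarrow> act r x = x) \<and>
     (\<forall>r\<in>reflections W S. \<forall>x\<in>X. \<forall>s\<in>S.
        ht (act r x) > ht x \<and> ht (act s (act r x)) < ht (act s x) \<longrightarrow> act r x = act s x)"

definition even_set ::
  "('w, 'c) monoid_scheme \<Rightarrow> 'w set \<Rightarrow> 'x set \<Rightarrow> ('w \<Rightarrow> 'x \<Rightarrow> 'x) \<Rightarrow> bool" where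
  "even_set W S X act \<longleftrightarrow>
     (\<forall>w\<in>carrier W. \<forall>x\<in>X. act w x = x \<longrightarrow> even (cox_length W S w))"

definition bounded_height :: "'x set \<Rightarrow> ('x \<Rightarrow> int) \<Rightarrow> bool" where
  "bounded_height X ht \<longleftrightarrow> bdd_below (ht ` X) \<or> bdd_above (ht ` X)"

definition bruhat_step ::
  "('w, 'c) monoid_scheme \<Rightarrow> 'w set \<Rightarrow> 'x set \<Rightarrow> ('w \<Rightarrow> 'x \<Rightarrow> 'x) \<Rightarrow> ('x \<Rightarrow> int) \<Rightarrow> 'x rel" where
  "bruhat_step W S X act ht =
     {(x, act r x) | x r. x \<in> X \<and> r \<in> reflections W S \<and> ht x < ht (act r x)}"

definition bruhat_order ::
  "('w, 'c) monoid_scheme \<Rightarrow> 'w set \<Rightarrow> 'x set \<Rightarrow> ('w \<Rightarrow> 'x \<Rightarrow> 'x) \<Rightarrow> ('x \<Rightarrow> int) \<Rightarrow> 'x rel" where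
  "bruhat_order W S X act ht = (bruhat_step W S X act ht)\<^sup>* \<inter> X \<times> X"


section \<open>The Moebius function of a poset\<close>

definition poset_interval :: "'x rel \<Rightarrow> 'x \<Rightarrow> 'x \<Rightarrow> 'x set" where
  "poset_interval L x y = {z. (x, z) \<in> L \<and> (z, y) \<in> L}"

text \<open>
  The usual recursion \<open>\<mu>(x,x) = 1\<close> and \<open>\<mu>(x,y) = - (\<Sum>x \<le> z < y. \<mu>(x,z))\<close> for \<open>x < y\<close>. The
  first two conjuncts of the guard make the recursion well-founded; where they fail, the Moebius
  function is undefined and \<^term>\<open>0\<close> is a dummy value.
\<close>

function moebius :: "'x set \<Rightarrow> 'x rel \<Rightarrow> 'x \<Rightarrow> 'x \<Rightarrow> int" where
  "moebius X L x y =
     (if partial_order_on X L \<and> finite (poset_interval L x y) \<and> (x, y) \<in> L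
      then if x = y then 1
           else - (\<Sum>z\<in>poset_interval L x y - {y}. moebius X L x z)
      else 0)"
  by pat_completeness auto
termination
proof (relation "measure (\<lambda>(X, L, x, y). card (poset_interval L x y))", goal_cases)
  case 1
  then show ?case by simp
next
  case (2 X L x y z)
  then have po: "partial_order_on X L" and fin: "finite (poset_interval L x y)"
    and xy: "(x, y) \<in> L" and z: "(x, z) \<in> L" "(z, y) \<in> L" "z \<noteq> y"
    by (auto simp: poset_interval_def)
  have tr: "trans L" and an: "antisym L" and rf: "refl_on X L" and LX: "L \<subseteq> X \<times> X"
    using po by (auto simp: partial_order_on_def preorder_on_def refl_on_def)
  have "poset_interval L x z \<subset> poset_interval L x y"
  proof
    show "poset_interval L x z \<subseteq> poset_interval L x y"
      using tr z by (auto simp: poset_interval_def dest: transD)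
    have "(y, y) \<in> L" using rf LX xy by (auto simp: refl_on_def)
    then have "y \<in> poset_interval L x y" using xy by (simp add: poset_interval_def)
    moreover have "y \<notin> poset_interval L x z"
      using an z by (auto simp: poset_interval_def dest: antisymD)
    ultimately show "poset_interval L x z \<noteq> poset_interval L x y" by blast
  qed
  then show ?case using psubset_card_mono[OF fin] by simp
qed

declare moebius.simps [simp del]

lemma partial_order_bruhat_order:
  "partial_order_on X (bruhat_order W S X act ht)"
proof -
  let ?B = "bruhat_step W S X act ht" and ?L = "bruhat_order W S X act ht"
  have mono: "x = y \<or> ht x < ht y" if "(x, y) \<in> ?B\<^sup>*" for x y
    using that by (induction rule: rtrancl_induct) (auto simp: bruhat_step_def)
  have "refl_on X ?L" "?L \<subseteq> X \<times> X"
    by (auto simp: refl_on_def bruhat_order_def)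
  moreover have "trans ?L"
    by (rule transI) (auto simp: bruhat_order_def)
  moreover have "antisym ?L"
    by (rule antisymI) (auto simp: bruhat_order_def dest!: mono)
  ultimately show ?thesis
    by (simp add: partial_order_on_def preorder_on_def)
qed

end

theory Submission
  imports Defs
begin

text \<open>
  Evenness makes every simple reflection change heights by exactly one, so that each pair
  \<open>{x, sx}\<close> has an upper and a lower element, and (QP2) makes both choices monotone in the
  Bruhat order. This is the lifting property. If the height is bounded below, an exchange
  argument from a lowest element of the orbit gives every non-minimal \<open>y\<close> a descent \<open>s\<close>;
  then everything below \<open>y\<close> lies in \<open>{z. z \<le> sy}\<close> or its image under \<open>s\<close>,
  whence intervals are finite. An interval \<open>[x, y]\<close> with \<open>sx > x\<close> and \<open>sy < y\<close> is \<open>s\<close>-stable, and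
  \<open>s\<close> exchanges the two height parities; if \<open>sx < x\<close> and \<open>sy < y\<close>, then
  \<open>[sx, y] - [x, y] = [sx, sy] - [x, sy]\<close> reduces the claim to an \<open>s\<close>-stable interval and to
  intervals ending in \<open>sy\<close>. Heights bounded above are handled by replacing \<open>ht\<close> with \<open>-ht\<close>, which
  reverses the Bruhat order.
\<close>

section \<open>Transitivity of the Bruhat order and its compatibility with heights\<close>

lemma bruhat_order_trans:
  "\<lbrakk>(x, y) \<in> bruhat_order W S X act ht; (y, z) \<in> bruhat_order W S X act ht\<rbrakk>
    \<Longrightarrow> (x, z) \<in> bruhat_order W S X act ht"
  by (auto simp: bruhat_order_def)

lemma bruhat_order_ht:
  assumes "(x, y) \<in> bruhat_order W S X act ht" "x \<noteq> y"
  shows "ht x < ht y"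
proof -
  have "x = y \<or> ht x < ht y" if "(x, y) \<in> (bruhat_step W S X act ht)\<^sup>*" for x y
    using that by (induction rule: rtrancl_induct) (auto simp: bruhat_step_def)
  then show ?thesis using assms by (auto simp: bruhat_order_def)
qed


section \<open>Even quasiparabolic sets\<close>

text \<open>Evenness enters as \<open>ht_simple\<close>: no simple reflection fixes a point, so by
  (QP1) it changes every height by exactly 1. The assumptions are preserved when \<open>ht\<close>
  is negated, which later settles heights bounded above.\<close>

locale even_quasiparabolic = group_action W X act
  for W :: "('w, 'c) monoid_scheme" (structure) and X :: "'x set" and act +
  fixes S :: "'w set" and ht :: "'x \<Rightarrow> int"
  assumes S_carrier: "S \<subseteq> carrier W"
    and S_invol: "s \<in> S \<Longrightarrow> s \<otimes> s = \<one>"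
    and S_generates: "word_eval W ` lists S = carrier W"
    and ht_simple: "\<lbrakk>s \<in> S; x \<in> X\<rbrakk> \<Longrightarrow> \<bar>ht (act s x) - ht x\<bar> = 1"
    and QP1: "\<lbrakk>r \<in> reflections W S; x \<in> X; ht (act r x) = ht x\<rbrakk> \<Longrightarrow> act r x = x"
    and QP2: "\<lbrakk>r \<in> reflections W S; x \<in> X; s \<in> S; ht x < ht (act r x);
       ht (act s (act r x)) < ht (act s x)\<rbrakk> \<Longrightarrow> act r x = act s x"
begin

sublocale grp: group W
  by (rule group_hom.axioms(1)[OF group_hom])

abbreviation R where "R \<equiv> reflections W S"
abbreviation ble (infix "\<preceq>" 50) where "x \<preceq> y \<equiv> (x, y) \<in> bruhat_order W S X act ht"

lemma S_in_carrier: "s \<in> S \<Longrightarrow> s \<in> carrier W"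
  using S_carrier by auto

lemma act_closed [simp]: "\<lbrakk>g \<in> carrier W; x \<in> X\<rbrakk> \<Longrightarrow> act g x \<in> X"
  using element_image by blast

lemma act_one [simp]: "x \<in> X \<Longrightarrow> act \<one> x = x"
  using id_eq_one by (metis restrict_apply')

lemma act_inv [simp]:
  assumes "g \<in> carrier W" "x \<in> X"
  shows "act (inv g) (act g x) = x" "act g (act (inv g) x) = x"
proof -
  show "act (inv g) (act g x) = x" using assms orbit_sym_aux by blast
  show "act g (act (inv g) x) = x"
    using assms orbit_sym_aux[of "inv g" x] grp.inv_inv by simp
qed

lemma act_invol: "\<lbrakk>g \<in> carrier W; g \<otimes> g = \<one>; x \<in> X\<rbrakk> \<Longrightarrow> act g (act g x) = x"
  by (metis act_one composition_rule)

lemma act_simple_simple [simp]: "\<lbrakk>s \<in> S; x \<in> X\<rbrakk> \<Longrightarrow> act s (act s x) = x"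
  by (simp add: act_invol S_in_carrier S_invol)

lemma act_simple_closed [simp]: "\<lbrakk>s \<in> S; x \<in> X\<rbrakk> \<Longrightarrow> act s x \<in> X"
  by (simp add: S_in_carrier)

lemma reflection_carrier: "r \<in> R \<Longrightarrow> r \<in> carrier W"
  by (auto simp: reflections_def S_in_carrier)

lemma reflection_invol:
  assumes "r \<in> R" shows "r \<otimes> r = \<one>"
proof -
  obtain w s where r: "r = w \<otimes> s \<otimes> inv w" and w: "w \<in> carrier W" and s: "s \<in> S"
    using assms by (auto simp: reflections_def)
  note [simp] = w S_in_carrier[OF s]
  have "r \<otimes> r = w \<otimes> (s \<otimes> (inv w \<otimes> w) \<otimes> s) \<otimes> inv w"
    unfolding r by (simp only: grp.m_assoc grp.m_closed grp.inv_closed w S_in_carrier[OF s])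
  also have "\<dots> = \<one>" using s by (simp add: S_invol)
  finally show ?thesis .
qed

lemma act_reflection_closed [simp]: "\<lbrakk>r \<in> R; x \<in> X\<rbrakk> \<Longrightarrow> act r x \<in> X"
  by (simp add: reflection_carrier)

lemma act_reflection_reflection [simp]: "\<lbrakk>r \<in> R; x \<in> X\<rbrakk> \<Longrightarrow> act r (act r x) = x"
  by (simp add: act_invol reflection_carrier reflection_invol)

lemma simple_reflection: "s \<in> S \<Longrightarrow> s \<in> R"
  unfolding reflections_def
  by (rule CollectI, rule exI[of _ \<one>], rule exI[of _ s]) (auto simp: S_in_carrier)

lemma reflection_conj:
  assumes "r \<in> R" "w \<in> carrier W" shows "w \<otimes> r \<otimes> inv w \<in> R"
proof -
  obtain v s where r: "r = v \<otimes> s \<otimes> inv v" and v: "v \<in> carrier W" and s: "s \<in> S"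
    using assms by (auto simp: reflections_def)
  have "w \<otimes> r \<otimes> inv w = (w \<otimes> v) \<otimes> s \<otimes> inv (w \<otimes> v)"
    using assms(2) v S_in_carrier[OF s] by (simp add: r grp.inv_mult_group grp.m_assoc)
  then show ?thesis using assms(2) v s by (auto simp: reflections_def)
qed

lemma act_conj:
  assumes "r \<in> carrier W" "w \<in> carrier W" "x \<in> X"
  shows "act (w \<otimes> r \<otimes> inv w) (act w x) = act w (act r x)"
  using assms by (simp add: composition_rule)

lemma act_reflection_up:
  assumes "r \<in> R" "x \<in> X" "ht x \<le> ht (act r x)"
  shows "x \<preceq> act r x"
proof (cases "ht x = ht (act r x)")
  case True
  then have "act r x = x" using QP1[OF assms(1,2)] by simp
  then show ?thesis using assms(2) by (simp add: bruhat_order_def)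
next
  case False
  then have "(x, act r x) \<in> bruhat_step W S X act ht"
    using assms by (auto simp: bruhat_step_def)
  then show ?thesis using assms by (auto simp: bruhat_order_def)
qed

lemma bruhat_carrier: "x \<preceq> y \<Longrightarrow> x \<in> X \<and> y \<in> X"
  by (auto simp: bruhat_order_def)

lemma bruhat_refl: "x \<in> X \<Longrightarrow> x \<preceq> x"
  by (auto simp: bruhat_order_def)

lemma act_simple_up:
  assumes "s \<in> S" "x \<in> X" "ht x < ht (act s x)"
  shows "x \<preceq> act s x"
  using assms by (intro act_reflection_up simple_reflection) auto

lemma act_simple_down:
  assumes "s \<in> S" "x \<in> X" "ht (act s x) < ht x"
  shows "act s x \<preceq> x"
  using act_simple_up[of s "act s x"] assms by simp

lemma simple_cases:
  assumes "s \<in> S" "x \<in> X"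
  obtains "ht (act s x) = ht x + 1" | "ht (act s x) = ht x - 1"
  using ht_simple[OF assms] by linarith


section \<open>The lifting property\<close>

text \<open>The upper and the lower element of the pair formed by \<open>x\<close> and
  \<open>sx\<close>. By \<open>ht_simple\<close> the two heights differ, so one comparison decides
  both.\<close>

definition up where "up s x = (if ht x < ht (act s x) then act s x else x)"
definition dn where "dn s x = (if ht x < ht (act s x) then x else act s x)"

text \<open>If \<open>y = rx\<close>, the conjugate reflection \<open>srs\<close> carries
  \<open>sx\<close> to \<open>sy\<close>, so these are comparable. The wrong order of heights is the
  situation of (QP2), which forces \<open>y = sx\<close>.\<close>

lemma bruhat_step_simple:
  assumes "(x, y) \<in> bruhat_step W S X act ht" "s \<in> S"
  shows "y = act s x \<or> act s x \<preceq> act s y"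
proof -
  obtain r where r: "r \<in> R" "x \<in> X" "y = act r x" "ht x < ht y"
    using assms(1) by (auto simp: bruhat_step_def)
  note s = S_in_carrier[OF assms(2)]
  have conj: "s \<otimes> r \<otimes> inv s \<in> R" "act (s \<otimes> r \<otimes> inv s) (act s x) = act s y"
    using r s by (auto simp: reflection_conj act_conj reflection_carrier)
  show ?thesis
  proof (cases "ht (act s y) < ht (act s x)")
    case True
    then show ?thesis using QP2 r assms(2) by auto
  next
    case False
    then show ?thesis using act_reflection_up[OF conj(1), of "act s x"] conj(2) r s by auto
  qed
qed

lemma up_ge: "\<lbrakk>s \<in> S; x \<in> X\<rbrakk> \<Longrightarrow> x \<preceq> up s x \<and> act s x \<preceq> up s x"
  by (cases rule: simple_cases[of s x])
    (auto simp: up_def bruhat_refl intro: act_simple_up act_simple_down)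

lemma dn_le: "\<lbrakk>s \<in> S; x \<in> X\<rbrakk> \<Longrightarrow> dn s x \<preceq> x \<and> dn s x \<preceq> act s x"
  by (cases rule: simple_cases[of s x])
    (auto simp: dn_def bruhat_refl intro: act_simple_up act_simple_down)

lemma up_act: "\<lbrakk>s \<in> S; x \<in> X\<rbrakk> \<Longrightarrow> up s (act s x) = up s x"
  by (cases rule: simple_cases[of s x]) (auto simp: up_def)

lemma dn_act: "\<lbrakk>s \<in> S; x \<in> X\<rbrakk> \<Longrightarrow> dn s (act s x) = dn s x"
  by (cases rule: simple_cases[of s x]) (auto simp: dn_def)

lemma up_least: "\<lbrakk>x \<preceq> z; act s x \<preceq> z\<rbrakk> \<Longrightarrow> up s x \<preceq> z"
  by (auto simp: up_def)

lemma dn_greatest: "\<lbrakk>z \<preceq> x; z \<preceq> act s x\<rbrakk> \<Longrightarrow> z \<preceq> dn s x"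
  by (auto simp: dn_def)

text \<open>If \<open>y = sx\<close>, both points give the same pair. Otherwise
  \<open>up s y\<close> lies above \<open>x\<close> and \<open>sx\<close>, and \<open>dn s x\<close>
  lies below \<open>y\<close> and \<open>sy\<close>.\<close>

lemma up_dn_mono_step:
  assumes st: "(x, y) \<in> bruhat_step W S X act ht" and s: "s \<in> S"
  shows "up s x \<preceq> up s y \<and> dn s x \<preceq> dn s y"
proof -
  have X: "x \<in> X" "y \<in> X" using st by (auto simp: bruhat_step_def)
  have xy: "x \<preceq> y" using st X by (auto simp: bruhat_order_def)
  note up = up_ge[OF s] and dn = dn_le[OF s]
  from bruhat_step_simple[OF st s] show ?thesis
  proof
    assume "y = act s x"
    then show ?thesis
      using X s up_act dn_act up[OF X(1)] dn[OF X(1)]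
      by (auto intro!: bruhat_refl dest: bruhat_carrier)
  next
    assume "act s x \<preceq> act s y"
    then show ?thesis
      using xy up[OF X(2)] dn[OF X(1)]
      by (blast intro: bruhat_order_trans up_least dn_greatest)
  qed
qed

lemma up_dn_mono:
  assumes "x \<preceq> y" and s: "s \<in> S"
  shows "up s x \<preceq> up s y \<and> dn s x \<preceq> dn s y"
proof -
  have "(x, y) \<in> (bruhat_step W S X act ht)\<^sup>*" "x \<in> X"
    using assms(1) by (auto simp: bruhat_order_def)
  then show ?thesis
  proof (induction rule: rtrancl_induct)
    case base
    then show ?case
      using up_ge[OF s base] dn_le[OF s base] by (auto intro: bruhat_refl dest: bruhat_carrier)
  next
    case (step y z)
    have "up s x \<preceq> up s y" "dn s x \<preceq> dn s y" using step.IH step.prems by auto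
    then show ?case
      using up_dn_mono_step[OF step.hyps(2) s] by (auto elim: bruhat_order_trans)
  qed
qed

lemma up_mono: "\<lbrakk>x \<preceq> y; s \<in> S\<rbrakk> \<Longrightarrow> up s x \<preceq> up s y"
  and dn_mono: "\<lbrakk>x \<preceq> y; s \<in> S\<rbrakk> \<Longrightarrow> dn s x \<preceq> dn s y"
  using up_dn_mono by auto


section \<open>Existence of descents\<close>

lemma word_eval_Nil [simp]: "word_eval W [] = \<one>"
  by (simp add: word_eval_def)

lemma word_eval_Cons [simp]: "word_eval W (s # ws) = s \<otimes> word_eval W ws"
  by (simp add: word_eval_def)

lemma word_eval_carrier [simp]: "ws \<in> lists S \<Longrightarrow> word_eval W ws \<in> carrier W"
  using S_generates by blast

lemma act_word_Cons:
  "\<lbrakk>s \<in> S; ws \<in> lists S; x \<in> X\<rbrakk>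
    \<Longrightarrow> act (word_eval W (s # ws)) x = act s (act (word_eval W ws) x)"
  by (simp add: composition_rule S_in_carrier)

lemma ht_word_le:
  assumes "ws \<in> lists S" "x \<in> X"
  shows "ht (act (word_eval W ws) x) \<le> ht x + int (length ws)"
  using assms
proof (induction ws)
  case (Cons s ws)
  then show ?case using ht_simple[of s "act (word_eval W ws) x"]
    by (auto simp del: word_eval_Cons simp: act_word_Cons)
qed simp

text \<open>Reading \<open>v\<close> from the right, conjugates of \<open>r\<close> join the images
  of \<open>x\<close> and \<open>rx\<close>. Their heights start in one order and end in the other;
  at the letter that reverses them, (QP2) allows that letter to be deleted.\<close>

lemma exchange:
  assumes "v \<in> lists S" "r \<in> R" "x \<in> X" "ht x < ht (act r x)"
    "ht (act (word_eval W v) (act r x)) < ht (act (word_eval W v) x)"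
  shows "\<exists>v'\<in>lists S. length v = Suc (length v') \<and>
     act (word_eval W v') x = act (word_eval W v) (act r x)"
  using assms
proof (induction v)
  case Nil
  then show ?case by simp
next
  case (Cons s v)
  then have s: "s \<in> S" and v: "v \<in> lists S" by auto
  let ?v = "word_eval W v"
  let ?r = "?v \<otimes> r \<otimes> inv ?v"
  note [simp del] = word_eval_Cons
  have conj: "?r \<in> R" "act ?r (act ?v x) = act ?v (act r x)"
    using \<open>r \<in> R\<close> \<open>x \<in> X\<close> v by (simp_all add: reflection_conj act_conj reflection_carrier)
  have flip: "ht (act s (act ?v (act r x))) < ht (act s (act ?v x))"
    using Cons.prems s v by (simp add: act_word_Cons)
  consider "ht (act ?v (act r x)) < ht (act ?v x)" | "ht (act ?v (act r x)) = ht (act ?v x)"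
    | "ht (act ?v x) < ht (act ?v (act r x))" by linarith
  then show ?case
  proof cases
    case 1
    then obtain v' where "v' \<in> lists S" "length v = Suc (length v')"
      "act (word_eval W v') x = act ?v (act r x)"
      using Cons.IH v Cons.prems by blast
    then show ?thesis
      using s v Cons.prems by (intro bexI[of _ "s # v'"]) (auto simp: act_word_Cons)
  next
    case 2
    then have "act ?v (act r x) = act ?v x"
      using QP1[OF conj(1), of "act ?v x"] conj(2) v Cons.prems by auto
    then show ?thesis using flip by simp
  next
    case 3
    \<comment> \<open>Here \<open>s\<close> is the reversing letter: \<open>v(rx) = s(vx)\<close>
      gives \<open>sv(rx) = vx\<close>, so \<open>v\<close> itself is the shorter word.\<close>
    then have "act ?v (act r x) = act s (act ?v x)"
      using QP2[OF conj(1), of "act ?v x" s] conj(2) v s Cons.prems flip by auto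
    then show ?thesis
      using s v Cons.prems by (intro bexI[of _ v]) (auto simp: act_word_Cons)
  qed
qed

text \<open>Induction on the word: a letter that raises the height is kept, and one that lowers it
  is absorbed by shortening the word through \<open>exchange\<close>.\<close>

lemma word_reduced:
  assumes m: "m \<in> X" and min: "\<And>r. r \<in> R \<Longrightarrow> ht m \<le> ht (act r m)" and "w \<in> lists S"
  shows "\<exists>v\<in>lists S. act (word_eval W v) m = act (word_eval W w) m \<and>
    ht (act (word_eval W v) m) = ht m + int (length v)"
  using assms(3)
proof (induction w)
  case Nil
  then show ?case using m by (intro bexI[of _ "[]"]) auto
next
  case (Cons s w)
  then have s: "s \<in> S" and w: "w \<in> lists S" by auto
  obtain v where v: "v \<in> lists S" and vw: "act (word_eval W v) m = act (word_eval W w) m"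
    and htv: "ht (act (word_eval W v) m) = ht m + int (length v)"
    using Cons.IH by blast
  let ?v = "word_eval W v"
  note [simp del] = word_eval_Cons
  have y: "act ?v m \<in> X" using v m by simp
  from s y show ?case
  proof (cases rule: simple_cases)
    case 1
    then show ?thesis
      using s v w vw htv m by (intro bexI[of _ "s # v"]) (auto simp: act_word_Cons)
  next
    case 2
    \<comment> \<open>Conjugating \<open>s\<close> by the inverse of \<open>v\<close> gives
      \<open>r\<close> with \<open>v(rm) = s(vm)\<close>. As \<open>s\<close> moves
      \<open>vm\<close>, \<open>r\<close> moves \<open>m\<close>, and upward by minimality and
      (QP1), while \<open>s\<close> lowers \<open>vm\<close>: this is the reversal that
      \<open>exchange\<close> asks for.\<close>
    let ?r = "inv ?v \<otimes> s \<otimes> inv (inv ?v)"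
    have r: "?r \<in> R" using s v by (intro reflection_conj simple_reflection) auto
    have "act ?r m = act (inv ?v) (act s (act ?v m))"
      using v s m S_in_carrier[OF s] by (simp add: composition_rule)
    then have vr: "act ?v (act ?r m) = act s (act ?v m)"
      using v s y by simp
    have "act ?r m \<noteq> m" using vr 2 by auto
    then have "ht m < ht (act ?r m)" using min[OF r] QP1[OF r m] by force
    then obtain v' where v': "v' \<in> lists S" "length v = Suc (length v')"
      "act (word_eval W v') m = act s (act ?v m)"
      using exchange[OF v r m] vr 2 by auto
    then show ?thesis
      using s w vw htv m 2 by (intro bexI[of _ v']) (auto simp: act_word_Cons)
  qed
qed

lemma bruhat_orbit:
  assumes "x \<preceq> y" shows "\<exists>g\<in>carrier W. x = act g y"
proof -
  have "(x, y) \<in> (bruhat_step W S X act ht)\<^sup>*" "x \<in> X"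
    using assms by (auto simp: bruhat_order_def)
  then show ?thesis
  proof (induction rule: rtrancl_induct)
    case base
    then show ?case by (intro bexI[of _ \<one>]) auto
  next
    case (step y z)
    then obtain g r where g: "g \<in> carrier W" "x = act g y"
      and r: "r \<in> R" "z = act r y" "y \<in> X"
      by (auto simp: bruhat_step_def)
    then show ?case
      by (intro bexI[of _ "g \<otimes> r"]) (auto simp: composition_rule reflection_carrier)
  qed
qed

text \<open>The point \<open>y\<close> is reached from a lowest point \<open>m\<close> of its orbit
  by a word gaining 1 in height per letter. The word is nonempty because \<open>x\<close> lies in
  the same orbit below \<open>y\<close>; deleting its first letter undoes the last step up, so that
  letter is a descent.\<close>

lemma descent_exists:
  assumes bdd: "bdd_below (ht ` X)" and xy: "x \<preceq> y" "x \<noteq> y"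
  shows "\<exists>s\<in>S. ht (act s y) < ht y"
proof -
  obtain b where b: "\<And>z. z \<in> X \<Longrightarrow> b \<le> ht z"
    using bdd by (auto simp: bdd_below_def)
  have X: "x \<in> X" "y \<in> X" using bruhat_carrier[OF xy(1)] by auto
  \<comment> \<open>Subtracting the lower bound turns heights into naturals, so a lowest point of
    the orbit exists.\<close>
  obtain g where g: "g \<in> carrier W"
    and least: "\<And>h. h \<in> carrier W \<Longrightarrow> nat (ht (act g y) - b) \<le> nat (ht (act h y) - b)"
    using ex_has_least_nat[of "\<lambda>g. g \<in> carrier W" \<one> "\<lambda>g. nat (ht (act g y) - b)"] by auto
  define m where "m = act g y"
  have m: "m \<in> X" using g X by (simp add: m_def)
  have min: "ht m \<le> ht (act h y)" if "h \<in> carrier W" for h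
    using least[OF that] b[of "act h y"] that X by (auto simp: m_def)
  have minR: "ht m \<le> ht (act r m)" if "r \<in> R" for r
    using min[of "r \<otimes> g"] that g X by (simp add: m_def composition_rule reflection_carrier)
  have y: "y = act (inv g) m" using g X by (simp add: m_def)
  obtain w where "w \<in> lists S" "word_eval W w = inv g"
    using S_generates g by (metis grp.inv_closed imageE)
  then obtain v where v: "v \<in> lists S" "y = act (word_eval W v) m"
    "ht y = ht m + int (length v)"
    using word_reduced[OF m minR] y by metis
  have "ht m < ht y"
    using bruhat_orbit[OF xy(1)] min bruhat_order_ht[OF xy] by fastforce
  with v obtain s u where su: "v = s # u" "s \<in> S" "u \<in> lists S" by (cases v) auto
  then have "act s y = act (word_eval W u) m"
    using v m by (simp del: word_eval_Cons add: act_word_Cons)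
  then have "ht (act s y) < ht y" using ht_word_le[of u m] su v m by simp
  then show ?thesis using su by auto
qed


section \<open>Intervals\<close>

lemma finite_lower_set:
  assumes bdd: "bdd_below (ht ` X)" and "y \<in> X"
  shows "finite {z. z \<preceq> y}"
proof -
  obtain b where b: "\<And>z. z \<in> X \<Longrightarrow> b \<le> ht z"
    using bdd by (auto simp: bdd_below_def)
  show ?thesis
    using assms(2)
  proof (induction "nat (ht y - b)" arbitrary: y rule: less_induct)
    case less
    show ?case
    proof (cases "\<exists>s\<in>S. ht (act s y) < ht y")
      case True
      then obtain s where s: "s \<in> S" "ht (act s y) < ht y" by blast
      have "finite {z. z \<preceq> act s y}"
        using less.hyps[of "act s y"] s less.prems b[of "act s y"] by simp
      moreover have "{z. z \<preceq> y} \<subseteq> {z. z \<preceq> act s y} \<union> act s ` {z. z \<preceq> act s y}"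
      proof (clarify)
        fix z assume z: "z \<preceq> y" "z \<notin> act s ` {z. z \<preceq> act s y}"
        have "dn s z \<preceq> act s y" using dn_mono[OF z(1) s(1)] s by (simp add: dn_def)
        moreover have "z = act s (act s z)" using z bruhat_carrier s by simp
        ultimately show "z \<preceq> act s y"
          using z by (auto simp: dn_def split: if_splits)
      qed
      ultimately show ?thesis by (meson finite_UnI finite_imageI finite_subset)
    next
      case False
      \<comment> \<open>Without a descent \<open>y\<close> is minimal, by contraposition of
        \<open>descent_exists\<close>.\<close>
      then have "{z. z \<preceq> y} \<subseteq> {y}" using descent_exists[OF bdd] by blast
      then show ?thesis using finite_subset by blast
    qed
  qed
qed

lemma finite_interval_below:
  assumes "bdd_below (ht ` X)" "y \<in> X"
  shows "finite (poset_interval (bruhat_order W S X act ht) x y)"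
  by (rule finite_subset[OF _ finite_lower_set[OF assms]]) (auto simp: poset_interval_def)

text \<open>This is (-1)^ht, written by parity because heights may be negative integers.\<close>

definition sgn_ht :: "'x \<Rightarrow> int" where "sgn_ht z = (if even (ht z) then 1 else -1)"

lemma sgn_ht_act: "\<lbrakk>s \<in> S; x \<in> X\<rbrakk> \<Longrightarrow> sgn_ht (act s x) = - sgn_ht x"
  by (cases rule: simple_cases[of s x]) (auto simp: sgn_ht_def)

text \<open>The involution \<open>s\<close> permutes \<open>A\<close> and reverses every sign, so
  the sum equals its own negative.\<close>

lemma sum_sgn_ht_stable:
  assumes "s \<in> S" "A \<subseteq> X" "\<And>z. z \<in> A \<Longrightarrow> act s z \<in> A"
  shows "sum sgn_ht A = 0"
proof -
  have "sum sgn_ht A = (\<Sum>z\<in>A. sgn_ht (act s z))"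
    by (rule sum.reindex_bij_witness[of _ "act s" "act s"]) (use assms in auto)
  also have "\<dots> = - sum sgn_ht A"
    using assms(1,2) by (simp add: sgn_ht_act subset_iff flip: sum_negf)
  finally show ?thesis by simp
qed

abbreviation ivl where "ivl x y \<equiv> poset_interval (bruhat_order W S X act ht) x y"

text \<open>Here \<open>dn s x = x\<close> and \<open>up s y = y\<close>, so monotonicity puts
  \<open>dn s z\<close> and \<open>up s z\<close>, hence also \<open>sz\<close>, between
  \<open>x\<close> and \<open>y\<close>.\<close>

lemma sum_sgn_ht_interval_stable:
  assumes s: "s \<in> S" and x: "ht x < ht (act s x)" and y: "ht (act s y) < ht y"
  shows "sum sgn_ht (ivl x y) = 0"
proof (rule sum_sgn_ht_stable[OF s])
  show "ivl x y \<subseteq> X" by (auto simp: poset_interval_def dest: bruhat_carrier)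
  fix z assume "z \<in> ivl x y"
  then have z: "x \<preceq> z" "z \<preceq> y" "z \<in> X"
    by (auto simp: poset_interval_def dest: bruhat_carrier)
  have "x \<preceq> dn s z" "up s z \<preceq> y"
    using dn_mono[OF z(1) s] up_mono[OF z(2) s] x y by (auto simp: dn_def up_def)
  then show "act s z \<in> ivl x y"
    using dn_le[OF s z(3)] up_ge[OF s z(3)]
    by (auto simp: poset_interval_def intro: bruhat_order_trans)
qed

text \<open>Induction on the height of \<open>y\<close>, with \<open>x\<close> arbitrary because the
  step applies the claim to intervals ending in \<open>sy\<close> that start at \<open>x\<close> and
  at \<open>sx\<close>.\<close>

lemma sum_sgn_ht_interval_below:
  assumes bdd: "bdd_below (ht ` X)" and "x \<preceq> y" "x \<noteq> y"
  shows "sum sgn_ht (ivl x y) = 0"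
proof -
  obtain b where b: "\<And>z. z \<in> X \<Longrightarrow> b \<le> ht z"
    using bdd by (auto simp: bdd_below_def)
  show ?thesis
    using assms(2,3)
  proof (induction "nat (ht y - b)" arbitrary: x y rule: less_induct)
    case less
    have X: "x \<in> X" "y \<in> X" using bruhat_carrier less.prems by auto
    obtain s where s: "s \<in> S" "ht (act s y) < ht y"
      using descent_exists[OF bdd less.prems] by auto
    let ?x = "act s x" and ?y = "act s y"
    show ?case
    proof (cases "ht x < ht ?x")
      case True
      then show ?thesis using sum_sgn_ht_interval_stable s by blast
    next
      case False
      then have x: "ht ?x < ht x" using ht_simple[OF s(1) X(1)] by linarith
      have X': "?x \<in> X" "?y \<in> X" using s X by auto
      have y_up: "ht ?y < ht (act s ?y)" and x_up: "ht ?x < ht (act s ?x)"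
        using s x X by auto
      have xle: "?x \<preceq> x" and yle: "?y \<preceq> y" using act_simple_down s x X by auto
      have xy: "?x \<preceq> ?y" using dn_mono[OF less.prems(1) s(1)] x s by (simp add: dn_def)
      have ne: "?x \<noteq> ?y" using s X less.prems(2) by (metis act_simple_simple)
      have "x \<noteq> ?y" using x y_up by auto
      have IH: "sum sgn_ht (ivl z ?y) = 0" if "z \<preceq> ?y" "z \<noteq> ?y" for z
        using less.hyps[OF _ that] s b[OF X'(2)] by simp
      \<comment> \<open>The point \<open>x\<close> need not lie below \<open>sy\<close>; if it does
        not, the interval is empty.\<close>
      have zero: "sum sgn_ht (ivl x ?y) = 0"
      proof (cases "x \<preceq> ?y")
        case False
        then have "ivl x ?y = {}" by (auto simp: poset_interval_def intro: bruhat_order_trans)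
        then show ?thesis by simp
      qed (use IH \<open>x \<noteq> ?y\<close> in blast)
      \<comment> \<open>A point \<open>z\<close> of \<open>[sx, y]\<close> not above
        \<open>x\<close> must be raised by \<open>s\<close>, since \<open>up s z\<close> is above
        \<open>up s (sx) = x\<close>. Then \<open>z = dn s z\<close> lies below
        \<open>dn s y = sy\<close>.\<close>
      have diff: "ivl ?x y - ivl x y = ivl ?x ?y - ivl x ?y"
      proof (intro equalityI subsetI)
        fix z assume "z \<in> ivl ?x y - ivl x y"
        then have z: "?x \<preceq> z" "z \<preceq> y" "\<not> x \<preceq> z" by (auto simp: poset_interval_def)
        have "ht z < ht (act s z)"
          using up_mono[OF z(1) s(1)] x_up z(3) s X by (auto simp: up_def split: if_splits)
        then have "z \<preceq> ?y" using dn_mono[OF z(2) s(1)] s(2) by (simp add: dn_def)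
        then show "z \<in> ivl ?x ?y - ivl x ?y" using z by (auto simp: poset_interval_def)
      qed (use yle in \<open>auto simp: poset_interval_def intro: bruhat_order_trans\<close>)
      have sub: "ivl x y \<subseteq> ivl ?x y" "ivl x ?y \<subseteq> ivl ?x ?y"
        using xle by (auto simp: poset_interval_def intro: bruhat_order_trans)
      note fin = finite_interval_below[OF bdd X(2)] finite_interval_below[OF bdd X'(2)]
      \<comment> \<open>The sets are finite, so equal differences give equal differences of sums;
        all terms but the one for \<open>[x, y]\<close> are known to vanish.\<close>
      have "sum sgn_ht (ivl ?x y) - sum sgn_ht (ivl x y) =
          sum sgn_ht (ivl ?x ?y) - sum sgn_ht (ivl x ?y)"
        using sum_diff[OF fin(1) sub(1), of sgn_ht] sum_diff[OF fin(2) sub(2), of sgn_ht] diff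
        by simp
      then show ?thesis
        using sum_sgn_ht_interval_stable[OF s(1) x_up s(2)] IH[OF xy ne] zero by simp
    qed
  qed
qed

section \<open>Reversal of the height\<close>

lemma even_quasiparabolic_dual: "even_quasiparabolic W X act S (\<lambda>x. - ht x)"
proof (unfold_locales, goal_cases)
  case (4 s x)
  then show ?case using ht_simple[of s x] by linarith
next
  case (5 r x)
  then show ?case using QP1 by auto
next
  case (6 r x s)
  \<comment> \<open>(QP2) for \<open>ht\<close> is applied at \<open>rx\<close>, where
    \<open>r\<close> leads up to \<open>x\<close>; it yields \<open>x = s(rx)\<close>, and applying
    \<open>s\<close> gives the claim.\<close>
  then have "act r (act r x) = act s (act r x)"
    using QP2[of r "act r x" s] by auto
  then show ?case using 6 by (metis act_reflection_closed act_reflection_reflection act_simple_simple)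
qed (use S_carrier S_invol S_generates in auto)

lemma bruhat_order_dual: "bruhat_order W S X act (\<lambda>x. - ht x) = (bruhat_order W S X act ht)\<inverse>"
proof -
  have "bruhat_step W S X act (\<lambda>x. - ht x) = (bruhat_step W S X act ht)\<inverse>"
  proof (intro equalityI subrelI)
    fix x y assume "(x, y) \<in> bruhat_step W S X act (\<lambda>x. - ht x)"
    then obtain r where "r \<in> R" "x \<in> X" "y = act r x" "ht y < ht x"
      by (auto simp: bruhat_step_def)
    then have "y \<in> X \<and> r \<in> R \<and> x = act r y \<and> ht y < ht (act r y)" by auto
    then show "(x, y) \<in> (bruhat_step W S X act ht)\<inverse>"
      unfolding bruhat_step_def by blast
  next
    fix x y assume "(x, y) \<in> (bruhat_step W S X act ht)\<inverse>"
    then obtain r where "r \<in> R" "y \<in> X" "x = act r y" "ht y < ht x"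
      by (auto simp: bruhat_step_def)
    then have "x \<in> X \<and> r \<in> R \<and> y = act r x \<and> - ht x < - ht (act r x)" by auto
    then show "(x, y) \<in> bruhat_step W S X act (\<lambda>x. - ht x)"
      unfolding bruhat_step_def by blast
  qed
  then show ?thesis by (auto simp: bruhat_order_def rtrancl_converse)
qed

lemma poset_interval_converse: "poset_interval (L\<inverse>) y x = poset_interval L x y"
  by (auto simp: poset_interval_def)

text \<open>Negating \<open>ht\<close> turns an upper bound into a lower one and reverses the order,
  while an interval stays the same set with its ends exchanged and signs do not change.\<close>

lemma interval_balanced:
  assumes "bounded_height X ht"
  shows finite_interval: "x \<in> X \<Longrightarrow> y \<in> X \<Longrightarrow> finite (ivl x y)"
    and sum_sgn_ht_interval: "x \<preceq> y \<Longrightarrow> x \<noteq> y \<Longrightarrow> sum sgn_ht (ivl x y) = 0"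
proof -
  interpret dual: even_quasiparabolic W X act S "\<lambda>x. - ht x"
    by (rule even_quasiparabolic_dual)
  have sgn: "dual.sgn_ht = sgn_ht" by (auto simp: dual.sgn_ht_def sgn_ht_def)
  note conv = bruhat_order_dual poset_interval_converse
  consider "bdd_below (ht ` X)" | "bdd_below ((\<lambda>x. - ht x) ` X)"
    using assms unfolding bounded_height_def
    by (metis bdd_above_uminus bdd_below_uminus image_image)
  then have "(x \<in> X \<longrightarrow> y \<in> X \<longrightarrow> finite (ivl x y)) \<and>
    (x \<preceq> y \<longrightarrow> x \<noteq> y \<longrightarrow> sum sgn_ht (ivl x y) = 0)"
  proof cases
    case 1
    then show ?thesis using finite_interval_below sum_sgn_ht_interval_below by blast
  next
    case 2
    then show ?thesis
      \<comment> \<open>Both facts concern the dual interval from \<open>y\<close> to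
        \<open>x\<close>; their variables are listed in different orders.\<close>
      using dual.finite_interval_below[of x y] dual.sum_sgn_ht_interval_below[of y x]
      by (auto simp: conv sgn)
  qed
  then show "x \<in> X \<Longrightarrow> y \<in> X \<Longrightarrow> finite (ivl x y)"
    and "x \<preceq> y \<Longrightarrow> x \<noteq> y \<Longrightarrow> sum sgn_ht (ivl x y) = 0" by auto
qed

section \<open>Parity counts and the Moebius function\<close>

lemma card_interval_balanced:
  assumes "bounded_height X ht" "x \<preceq> y" "x \<noteq> y"
  shows "card {z \<in> ivl x y. odd (ht z)} = card {z \<in> ivl x y. even (ht z)}"
proof -
  have fin: "finite (ivl x y)" using finite_interval assms bruhat_carrier by blast
  have "sum sgn_ht (ivl x y) =
      int (card {z \<in> ivl x y. even (ht z)}) - int (card {z \<in> ivl x y. odd (ht z)})"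
    using fin by (simp add: sgn_ht_def sum.If_cases Int_def Collect_neg_eq[symmetric])
  then show ?thesis using sum_sgn_ht_interval[OF assms] by simp
qed

text \<open>The product form lets \<open>sgn_ht x\<close> leave the recursive sum; what remains is
  the vanishing signed sum of the interval without the term of \<open>y\<close>.\<close>

lemma moebius_bruhat_order:
  assumes bdd: "bounded_height X ht" and "x \<preceq> y"
  shows "moebius X (bruhat_order W S X act ht) x y = sgn_ht x * sgn_ht y"
  using assms(2)
proof (induction "nat (ht y - ht x)" arbitrary: y rule: less_induct)
  case less
  note X = bruhat_carrier[OF less.prems]
  have fin: "finite (ivl x y)" using finite_interval[OF bdd] X by blast
  note rec = moebius.simps[of X "bruhat_order W S X act ht" x y]
    and po = partial_order_bruhat_order[of X W S act ht]
  have sq: "sgn_ht x * sgn_ht x = 1" by (simp add: sgn_ht_def)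
  show ?case
  proof (cases "x = y")
    case True
    then show ?thesis using rec fin less.prems po sq by auto
  next
    case False
    have "moebius X (bruhat_order W S X act ht) x z = sgn_ht x * sgn_ht z"
      if "z \<in> ivl x y - {y}" for z
    proof (rule less.hyps)
      show xz: "x \<preceq> z" using that by (simp add: poset_interval_def)
      have "z \<preceq> y" "z \<noteq> y" using that by (auto simp: poset_interval_def)
      then have "ht z < ht y" by (rule bruhat_order_ht)
      moreover have "ht x \<le> ht z" using bruhat_order_ht[OF xz] by (cases "x = z") auto
      ultimately show "nat (ht z - ht x) < nat (ht y - ht x)" by simp
    qed
    then have "moebius X (bruhat_order W S X act ht) x y =
        - (sgn_ht x * sum sgn_ht (ivl x y - {y}))"
      using rec fin less.prems False po
      by (simp add: sum_distrib_left)
    moreover have "y \<in> ivl x y" using less.prems X bruhat_refl by (auto simp: poset_interval_def)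
    then have "sgn_ht y = - sum sgn_ht (ivl x y - {y})"
      using sum_sgn_ht_interval[OF bdd less.prems False] sum.remove[OF fin, of y sgn_ht] by simp
    ultimately show ?thesis by simp
  qed
qed

text \<open>The sum and the difference of two heights have the same parity; the order makes the
  difference nonnegative, so \<open>nat\<close> loses nothing.\<close>

lemma sgn_ht_mult:
  assumes "x \<preceq> y" shows "sgn_ht x * sgn_ht y = (-1) ^ nat (ht y - ht x)"
proof -
  have "ht x \<le> ht y" using bruhat_order_ht[OF assms] by (cases "x = y") auto
  then have "even (nat (ht y - ht x)) \<longleftrightarrow> (even (ht y) \<longleftrightarrow> even (ht x))"
    by (simp add: even_nat_iff)
  then show ?thesis by (auto simp: sgn_ht_def)
qed

end


section \<open>Coxeter systems\<close>

text \<open>A relator has \<open>2 m(s,t)\<close> letters, none when the value 0 stands for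
  infinity. So length parity depends only on the element, which keeps \<open>[s]\<close> apart from
  the empty word.\<close>

lemma coxeter_step_parity: "coxeter_step S m u v \<Longrightarrow> even (length u) \<longleftrightarrow> even (length v)"
  by (induction rule: coxeter_step.induct) (auto simp: length_concat sum_list_replicate)

lemma equivclp_coxeter_step_parity:
  "equivclp (coxeter_step S m) u v \<Longrightarrow> even (length u) \<longleftrightarrow> even (length v)"
  by (induction rule: equivclp_induct) (auto dest: coxeter_step_parity)

lemma coxeter_simple_ne_one:
  assumes "coxeter_system W S" "s \<in> S"
  shows "s \<noteq> \<one>\<^bsub>W\<^esub>"
proof
  assume "s = \<one>\<^bsub>W\<^esub>"
  moreover obtain m where "word_eval W [s] = word_eval W [] \<longleftrightarrow> equivclp (coxeter_step S m) [s] []"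
    using assms unfolding coxeter_system_def by force
  moreover have "group W" using assms by (simp add: coxeter_system_def)
  ultimately have "equivclp (coxeter_step S m) [s] []"
    by (simp add: word_eval_def group.is_monoid monoid.l_one)
  then show False using equivclp_coxeter_step_parity by force
qed

lemma coxeter_simple_invol:
  assumes "coxeter_system W S" "s \<in> S"
  shows "s \<otimes>\<^bsub>W\<^esub> s = \<one>\<^bsub>W\<^esub>"
proof -
  obtain m where m: "m s s = 1"
    and eq: "word_eval W [] = word_eval W [s, s] \<longleftrightarrow> equivclp (coxeter_step S m) [] [s, s]"
    using assms unfolding coxeter_system_def coxeter_matrix_def by force
  have "coxeter_step S m [] [s, s]"
    using coxeter_step.intros[of "[]" S "[]" s s m] m assms(2) by simp
  then have "word_eval W [s, s] = \<one>\<^bsub>W\<^esub>"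
    using eq by (auto simp: word_eval_def)
  moreover have "group W" "s \<in> carrier W" using assms by (auto simp: coxeter_system_def)
  ultimately show ?thesis
    by (simp add: word_eval_def group.is_monoid monoid.r_one)
qed

text \<open>With \<open>even_set\<close>, this odd length means that \<open>s\<close> fixes no
  point.\<close>

lemma cox_length_simple:
  assumes "coxeter_system W S" "s \<in> S"
  shows "cox_length W S s = 1"
proof -
  have W: "group W" "s \<in> carrier W" using assms by (auto simp: coxeter_system_def)
  show ?thesis
    unfolding cox_length_def
  proof (rule Least_equality)
    show "\<exists>ws\<in>lists S. length ws = 1 \<and> word_eval W ws = s"
      using W assms(2)
      by (intro bexI[of _ "[s]"]) (auto simp: word_eval_def group.is_monoid monoid.r_one)
    fix n assume "\<exists>ws\<in>lists S. length ws = n \<and> word_eval W ws = s"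
    then show "1 \<le> n"
      using coxeter_simple_ne_one[OF assms] by (cases n) (auto simp: word_eval_def)
  qed
qed

lemma even_quasiparabolicI:
  assumes cox: "coxeter_system W S" and qp: "quasiparabolic_set W S X act ht"
    and ev: "even_set W S X act"
  shows "even_quasiparabolic W X act S ht"
proof -
  have act: "group_action W X act"
    using qp by (simp add: quasiparabolic_set_def scaled_set_def)
  interpret group_action W X act by (rule act)
  interpret grp: group W using cox by (simp add: coxeter_system_def)
  have S: "S \<subseteq> carrier W" using cox by (simp add: coxeter_system_def)
  show ?thesis
  proof (unfold_locales, goal_cases)
    case 3
    then show ?case using cox by (auto simp: coxeter_system_def)
  next
    case (4 s x)
    then have sW: "s \<in> carrier W" using S by auto
    have "act s x \<noteq> x"
      using ev cox_length_simple[OF cox 4(1)] 4 sW unfolding even_set_def by fastforce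
    moreover have "s \<in> reflections W S"
      unfolding reflections_def using 4 sW
      by (intro CollectI exI[of _ "\<one>\<^bsub>W\<^esub>"] exI[of _ s]) auto
    \<comment> \<open>By (QP1) equal heights would make \<open>x\<close> a fixed point of
      \<open>s\<close>.\<close>
    ultimately have "ht (act s x) \<noteq> ht x" using qp 4 unfolding quasiparabolic_set_def by blast
    moreover have "\<bar>ht (act s x) - ht x\<bar> \<le> 1"
      using qp 4 by (auto simp: quasiparabolic_set_def scaled_set_def)
    ultimately show ?case by linarith
  qed (use S coxeter_simple_invol[OF cox] qp in \<open>auto simp: quasiparabolic_set_def\<close>)
qed

theorem theorem6p1:
  fixes W :: "('w, 'c) monoid_scheme" and S :: "'w set"
    and X :: "'x set" and act :: "'w \<Rightarrow> 'x \<Rightarrow> 'x" and ht :: "'x \<Rightarrow> int"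
  assumes "coxeter_system W S"
    and "quasiparabolic_set W S X act ht"
    and "even_set W S X act"
    and "bounded_height X ht"
  shows "let L = bruhat_order W S X act ht in
      (\<forall>x\<in>X. \<forall>y\<in>X. finite (poset_interval L x y)) \<and>
      (\<forall>x\<in>X. \<forall>y\<in>X. moebius X L x y =
         (if (x, y) \<in> L then (-1) ^ nat (ht y - ht x) else 0)) \<and>
      (\<forall>x\<in>X. \<forall>y\<in>X. (x, y) \<in> L \<and> x \<noteq> y \<longrightarrow>
         card {z \<in> poset_interval L x y. odd (ht z)} =
         card {z \<in> poset_interval L x y. even (ht z)})"
proof -
  interpret even_quasiparabolic W X act S ht
    by (rule even_quasiparabolicI[OF assms(1-3)])
  have "moebius X (bruhat_order W S X act ht) x y =
      (if x \<preceq> y then (-1) ^ nat (ht y - ht x) else 0)" for x y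
  proof (cases "x \<preceq> y")
    case True
    then show ?thesis using moebius_bruhat_order[OF assms(4)] sgn_ht_mult by simp
  \<comment> \<open>If \<open>x\<close> is not below \<open>y\<close>, the guard of
    \<open>moebius\<close> fails and its value is 0.\<close>
  qed (simp add: moebius.simps)
  then show ?thesis
    using finite_interval[OF assms(4)] card_interval_balanced[OF assms(4)]
    by (simp add: Let_def)
qed

end
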